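(* Let $0<q\le1$, let $y\in\mathcal{R}(A)$ and let $x^\dagger\in X$ be the uniquely determined solution of $Ax=y$. Assume that $x^\dagger\in\mathcal{M}_{q,w}$, and that for all $k\in\operatorname{supp}(x^\dagger)$ there exists $f_k\in Y^*$ (fixed in what follows) such that $u_k=A^*f_k$. Then the variational inequality $$\mathcal{R}_{q,w}(x-x^\dagger)\le\mathcal{R}_{q,w}(x)-\mathcal{R}_{q,w}(x^\dagger)+\varphi_{q,w}\left(\|A(x-x^\dagger)\|_Y\right)$$ holds for all $x\in\mathcal{M}_{q,w}$ with the concave index function $$\varphi_{q,w}(t):=2\inf_{n\in\mathbb{N}}\left(\sum_{k=n+1}^\infty w_k|\langle x^\dagger,u_k\rangle_X|^q+t^q\sum_{k\in S_n(x^\dagger)}w_k\|f_k\|_{Y^*}^q\right),\qquad S_n(x^\dagger)=\operatorname{supp}(x^\dagger)\cap\{1,\dots,n\}.$$ In particular, $\varphi_{q,w}$ is a concave index function.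
   Context: $X$ is an infinite-dimensional separable real Hilbert space, $Y$ is a Banach space with dual $Y^*$, and $A:X\to Y$ is a bounded injective linear operator with non-closed range $\mathcal{R}(A)$. Identifying $X$ with its dual, $A^*:Y^*\to X$ is defined by $\langle f,Ax\rangle_{Y^*\times Y}=\langle A^*f,x\rangle_X$ for all $x\in X$, $f\in Y^*$. $\{u_k\}_{k\in\mathbb{N}}$ ($\mathbb{N}=\{1,2,\dots\}$) is a fixed orthonormal basis of $X$ and $(w_k)_{k\in\mathbb{N}}$ are fixed weights with $0<w_0\le w_k$ for all $k\in\mathbb{N}$, for some constant $w_0$. Set $$\mathcal{R}_{q,w}(x)=\sum_{k=1}^\infty w_k|\langle x,u_k\rangle_X|^q,\qquad \mathcal{M}_{q,w}=\{x\in X:\mathcal{R}_{q,w}(x)<\infty\},$$ and $\operatorname{supp}(x)=\{k\in\mathbb{N}:\langle x,u_k\rangle_X\ne0\}$. An index function is an increasing function $\varphi:(0,\infty)\to(0,\infty)$ with $\lim_{t\to+0}\varphi(t)=0$.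
   Formalization: That φ_{q,w} is an index function is claimed only for x† ≠ 0, since for x† = 0 it vanishes identically and is not (0,∞)-valued; "increasing" is read as non-decreasing, since φ_{q,w} is eventually constant when ⟨x†,u_1⟩ = 0. *)

theory Defs
  imports "HOL-Analysis.Analysis"
begin

section \<open>The adjoint of an operator from a Hilbert space to a Banach space\<close>

lemma riesz_representation:
  fixes f :: "'a::{real_inner, complete_space} \<Rightarrow>\<^sub>L real"
  shows "\<exists>z. \<forall>x. blinfun_apply f x = z \<bullet> x"
proof -
  define J where "J x = x \<bullet> x - 2 * blinfun_apply f x" for x
  have lower: "- (norm f)\<^sup>2 \<le> J x" for x
  proof -
    have "blinfun_apply f x \<le> norm f * norm x"
      using norm_blinfun[of f x] by simp
    moreover have "0 \<le> (norm x - norm f)\<^sup>2" by simp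
    ultimately show ?thesis
      unfolding J_def by (simp add: power2_eq_square algebra_simps dot_square_norm)
  qed
  define m where "m = Inf (range J)"
  have bdd: "bdd_below (range J)"
    using lower by (auto intro!: bdd_belowI)
  have m_le: "m \<le> J x" for x
    unfolding m_def by (rule cInf_lower[OF _ bdd]) simp
  have "\<exists>x. J x < m + 1 / real (Suc n)" for n
  proof -
    have "Inf (range J) < m + 1 / real (Suc n)" by (simp add: m_def)
    then show ?thesis using cInf_lessD[of "range J"] by auto
  qed
  then obtain X where X: "\<And>n. J (X n) < m + 1 / real (Suc n)" by metis
  have para: "(norm (x - y))\<^sup>2 = 2 * (J x + J y - 2 * J ((1/2) *\<^sub>R (x + y)))" for x y
    unfolding J_def power2_norm_eq_inner
    by (simp add: algebra_simps inner_commute blinfun.add_right blinfun.scaleR_right)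
  have "Cauchy X"
  proof (rule metric_CauchyI)
    fix e :: real assume e: "0 < e"
    then obtain N where N: "1 / real (Suc N) < e\<^sup>2 / 4"
      using nat_approx_posE[of "e\<^sup>2 / 4"] by auto
    have "dist (X i) (X j) < e" if "i \<ge> N" "j \<ge> N" for i j
    proof -
      have J_less: "J (X k) < m + e\<^sup>2 / 4" if "k \<ge> N" for k
      proof -
        have "1 / real (Suc k) \<le> 1 / real (Suc N)"
          using that by (simp add: frac_le)
        then show ?thesis using X[of k] N by argo
      qed
      have "(norm (X i - X j))\<^sup>2 < e\<^sup>2"
        using para[of "X i" "X j"] m_le[of "(1/2) *\<^sub>R (X i + X j)"]
          J_less[OF that(1)] J_less[OF that(2)] by argo
      then show ?thesis
        using e by (simp add: dist_norm power2_less_imp_less)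
    qed
    then show "\<exists>M. \<forall>i\<ge>M. \<forall>j\<ge>M. dist (X i) (X j) < e" by blast
  qed
  then obtain z where z: "X \<longlonglongrightarrow> z"
    by (auto simp: Cauchy_convergent_iff convergent_def)
  have "(\<lambda>n. J (X n)) \<longlonglongrightarrow> J z"
    unfolding J_def by (intro tendsto_intros z)
  moreover have "(\<lambda>n. m + 1 / real (Suc n)) \<longlonglongrightarrow> m + 0"
    by (intro tendsto_intros LIMSEQ_Suc[OF lim_1_over_n])
  ultimately have Jz: "J z \<le> m"
    using LIMSEQ_le[of "\<lambda>n. J (X n)" "J z" "\<lambda>n. m + 1 / real (Suc n)" "m + 0"] X
    by (simp add: less_imp_le del: of_nat_Suc)
  have "blinfun_apply f h = z \<bullet> h" for h
  proof (cases "h = 0")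
    case True
    then show ?thesis by simp
  next
    case False
    define c where "c = z \<bullet> h - blinfun_apply f h"
    define t where "t = - c / (h \<bullet> h)"
    have "J (z + t *\<^sub>R h) = J z + 2 * t * c + t * t * (h \<bullet> h)"
      unfolding J_def c_def
      by (simp add: algebra_simps inner_commute blinfun.add_right blinfun.scaleR_right)
    also have "\<dots> = J z - c\<^sup>2 / (h \<bullet> h)"
      using False unfolding t_def by (simp add: field_simps power2_eq_square)
    finally have "c\<^sup>2 / (h \<bullet> h) \<le> 0"
      using m_le[of "z + t *\<^sub>R h"] Jz by linarith
    then have "c = 0"
      using False inner_gt_zero_iff[of h]
      by (smt (verit) divide_pos_pos zero_less_power2)
    then show ?thesis by (simp add: c_def)
  qed
  then show ?thesis by blast
qed

definition dual_adjoint ::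
    "('a::{real_inner, complete_space} \<Rightarrow>\<^sub>L 'b::banach) \<Rightarrow> ('b \<Rightarrow>\<^sub>L real) \<Rightarrow> 'a"
  where "dual_adjoint A f =
    (THE z. \<forall>x. blinfun_apply f (blinfun_apply A x) = z \<bullet> x)"

lemma dual_adjoint:
  "blinfun_apply f (blinfun_apply A x) = dual_adjoint A f \<bullet> x"
proof -
  obtain z where z: "\<forall>x. blinfun_apply f (blinfun_apply A x) = z \<bullet> x"
    using riesz_representation[of "f o\<^sub>L A"] by auto
  have "\<forall>x. blinfun_apply f (blinfun_apply A x) = dual_adjoint A f \<bullet> x"
    unfolding dual_adjoint_def
  proof (rule theI)
    show "\<forall>x. blinfun_apply f (blinfun_apply A x) = z \<bullet> x" by (fact z)
    show "z' = z" if "\<forall>x. blinfun_apply f (blinfun_apply A x) = z' \<bullet> x" for z'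
      using that z by (metis vector_eq_rdot)
  qed
  then show ?thesis by blast
qed


section \<open>Sparsity-promoting penalties\<close>

text \<open>
  All sequences are indexed by the positive integers: a family \<open>u :: nat \<Rightarrow> 'a\<close> is only
  ever used at indices \<open>k \<ge> 1\<close>, and its value at \<open>0\<close> is irrelevant.
\<close>

definition orthonormal_basis :: "(nat \<Rightarrow> 'a::real_inner) \<Rightarrow> bool"
  where "orthonormal_basis u \<longleftrightarrow>
    (\<forall>i\<ge>1. \<forall>j\<ge>1. u i \<bullet> u j = (if i = j then 1 else 0)) \<and>
    closure (span (u ` {1..})) = UNIV"

text \<open>
  The penalty takes values in \<open>[0, \<infinity>]\<close>; it is typed in \<^typ>\<open>ereal\<close> rather than
  \<^typ>\<open>ennreal\<close> because differences of penalties, which may be negative, have to be formed.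
  Since \<open>0 powr q = 0\<close>, vanishing coefficients contribute nothing.
\<close>

definition penalty ::
    "real \<Rightarrow> (nat \<Rightarrow> real) \<Rightarrow> (nat \<Rightarrow> 'a::real_inner) \<Rightarrow> 'a \<Rightarrow> ereal"
  where "penalty q w u x = (\<Sum>k. ereal (w (k + 1) * \<bar>x \<bullet> u (k + 1)\<bar> powr q))"

definition penalty_domain ::
    "real \<Rightarrow> (nat \<Rightarrow> real) \<Rightarrow> (nat \<Rightarrow> 'a::real_inner) \<Rightarrow> 'a set"
  where "penalty_domain q w u = {x. penalty q w u x < \<infinity>}"

definition coeff_supp :: "(nat \<Rightarrow> 'a::real_inner) \<Rightarrow> 'a \<Rightarrow> nat set"
  where "coeff_supp u x = {k. 1 \<le> k \<and> x \<bullet> u k \<noteq> 0}"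

text \<open>
  The family \<open>f\<close> only enters through the indices in \<^term>\<open>coeff_supp u xd\<close>. The series is
  a real one, convergent as soon as \<open>xd\<close> lies in \<^term>\<open>penalty_domain q w u\<close>. The formula
  also makes sense at \<open>t = 0\<close>, where \<open>0 powr q = 0\<close> for positive \<open>q\<close>.
\<close>

definition rate_function ::
    "real \<Rightarrow> (nat \<Rightarrow> real) \<Rightarrow> (nat \<Rightarrow> 'a::real_inner) \<Rightarrow>
     (nat \<Rightarrow> ('b::real_normed_vector \<Rightarrow>\<^sub>L real)) \<Rightarrow> 'a \<Rightarrow> real \<Rightarrow> real"
  where "rate_function q w u f xd t =
    2 * (INF n\<in>{1..}.
          (\<Sum>j. w (n + 1 + j) * \<bar>xd \<bullet> u (n + 1 + j)\<bar> powr q)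
          + t powr q * (\<Sum>k\<in>coeff_supp u xd \<inter> {1..n}. w k * norm (f k) powr q))"

text \<open>
  Increasing is meant in the weak sense: if \<open>xd \<bullet> u 1 = 0\<close>, then the rate function is
  constant for large arguments.
\<close>

definition index_function :: "(real \<Rightarrow> real) \<Rightarrow> bool"
  where "index_function \<phi> \<longleftrightarrow>
    (\<forall>t>0. \<phi> t > 0) \<and> mono_on {0<..} \<phi> \<and> (\<phi> \<longlongrightarrow> 0) (at_right 0)"

end

theory Submission
  imports Defs
begin

text \<open>
  Subadditivity of \<open>s \<mapsto> s\<^sup>q\<close> shows that the \<open>k\<close>-th term of
  \<open>\<R>(x - x\<^sup>\<dagger>) - \<R>(x) + \<R>(x\<^sup>\<dagger>)\<close> is at most twice the \<open>k\<close>-th term of \<open>\<R>(x\<^sup>\<dagger>)\<close> and also at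
  most twice the \<open>k\<close>-th term of \<open>\<R>(x - x\<^sup>\<dagger>)\<close>. The first bound is used for \<open>k > n\<close>, the
  second for \<open>k \<le> n\<close>, where the source condition gives
  \<open>\<bar>\<langle>x - x\<^sup>\<dagger>, u\<^sub>k\<rangle>\<bar> = \<bar>\<langle>f\<^sub>k, A (x - x\<^sup>\<dagger>)\<rangle>\<bar> \<le> \<parallel>f\<^sub>k\<parallel> \<parallel>A (x - x\<^sup>\<dagger>)\<parallel>\<close>.
\<close>

section \<open>Powers with exponent at most one, and concavity of infima\<close>

text \<open>Normalise by \<open>a + b\<close>: both fractions lie in [0,1], where raising to a power
  \<open>q\<close> \<le> 1 can only increase a number, and the fractions sum to 1.\<close>

lemma powr_add_le_add_powr:
  fixes a b q :: real
  assumes "0 \<le> a" "0 \<le> b" "0 < q" "q \<le> 1"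
  shows "(a + b) powr q \<le> a powr q + b powr q"
proof (cases "a + b = 0")
  case False
  then have pos: "0 < a + b" using assms by linarith
  have le: "c / (a + b) \<le> (c / (a + b)) powr q" if "0 \<le> c" "c \<le> a + b" for c
    using powr_mono'[of q 1 "c / (a + b)"] that pos assms by simp
  have "1 = a / (a + b) + b / (a + b)"
    using pos by (simp add: add_divide_distrib[symmetric])
  also have "\<dots> \<le> (a / (a + b)) powr q + (b / (a + b)) powr q"
    using le[of a] le[of b] assms by linarith
  also have "\<dots> = (a powr q + b powr q) / (a + b) powr q"
    using assms by (simp add: powr_divide add_divide_distrib)
  finally show ?thesis
    using pos by (simp add: field_simps)
qed (use assms in auto)

lemma abs_diff_powr_le:
  fixes a b q :: real
  assumes "0 < q" "q \<le> 1"
  shows "\<bar>a - b\<bar> powr q \<le> \<bar>a\<bar> powr q + \<bar>b\<bar> powr q"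
proof -
  have "\<bar>a - b\<bar> powr q \<le> (\<bar>a\<bar> + \<bar>b\<bar>) powr q"
    using assms by (intro powr_mono2) auto
  then show ?thesis
    using powr_add_le_add_powr[of "\<bar>a\<bar>" "\<bar>b\<bar>" q] assms by simp
qed

lemma powr_concave:
  fixes q :: real
  assumes "0 \<le> q" "q \<le> 1"
  shows "concave_on {0<..} (\<lambda>x. x powr q)"
proof (rule f''_le0_imp_concave)
  show "((\<lambda>x. x powr q) has_real_derivative q * x powr (q - 1)) (at x)"
    if "x \<in> {0<..}" for x
    using that by (auto intro!: derivative_eq_intros)
  show "((\<lambda>x. q * x powr (q - 1)) has_real_derivative q * ((q - 1) * x powr (q - 2))) (at x)"
    if "x \<in> {0<..}" for x
    using that by (auto intro!: derivative_eq_intros)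
  show "q * ((q - 1) * x powr (q - 2)) \<le> 0" for x :: real
    using assms by (simp add: mult_nonneg_nonpos mult_nonpos_nonneg)
qed simp

text \<open>The convex combination of the two infima lies below that of the values of each single
  \<open>F i\<close>, hence below \<open>F i\<close> at the combined point. Boundedness below makes
  the real-valued infimum a genuine lower bound.\<close>

lemma concave_on_INF:
  fixes F :: "'i \<Rightarrow> 'a::real_vector \<Rightarrow> real"
  assumes "I \<noteq> {}" and "\<And>i. i \<in> I \<Longrightarrow> concave_on S (F i)"
    and bdd: "\<And>x. x \<in> S \<Longrightarrow> bdd_below ((\<lambda>i. F i x) ` I)"
  shows "concave_on S (\<lambda>x. INF i\<in>I. F i x)"
  unfolding concave_on_iff
proof (intro conjI ballI allI impI)
  show "convex S" using assms(1,2) by (auto simp: concave_on_iff)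
  fix x y and a b :: real
  assume xy: "x \<in> S" "y \<in> S" and ab: "0 \<le> a" "0 \<le> b" "a + b = 1"
  show "a * (INF i\<in>I. F i x) + b * (INF i\<in>I. F i y) \<le> (INF i\<in>I. F i (a *\<^sub>R x + b *\<^sub>R y))"
  proof (rule cINF_greatest[OF \<open>I \<noteq> {}\<close>])
    fix i assume i: "i \<in> I"
    have "a * (INF i\<in>I. F i x) + b * (INF i\<in>I. F i y) \<le> a * F i x + b * F i y"
      using i xy ab by (intro add_mono mult_left_mono cINF_lower bdd)
    also have "\<dots> \<le> F i (a *\<^sub>R x + b *\<^sub>R y)"
      using assms(2)[OF i] xy ab by (auto simp: concave_on_iff)
    finally show "a * (INF i\<in>I. F i x) + b * (INF i\<in>I. F i y) \<le> F i (a *\<^sub>R x + b *\<^sub>R y)" .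
  qed
qed

section \<open>Completeness of the basis, and penalties as real series\<close>

text \<open>The vectors orthogonal to \<open>x\<close> form a closed subspace. If it contains the
  basis, it is the whole space and so contains \<open>x\<close> itself.\<close>

lemma orthonormal_basis_inner_eq_0:
  fixes u :: "nat \<Rightarrow> 'a::real_inner"
  assumes "orthonormal_basis u" "\<And>k. 1 \<le> k \<Longrightarrow> x \<bullet> u k = 0"
  shows "x = 0"
proof -
  have "span (u ` {1..}) \<subseteq> {z. x \<bullet> z = 0}"
    using assms(2) by (intro span_minimal subspace_hyperplane) auto
  then have "closure (span (u ` {1..})) \<subseteq> {z. x \<bullet> z = 0}"
    by (rule closure_minimal[OF _ closed_hyperplane])
  then have "x \<in> {z. x \<bullet> z = 0}"
    using assms(1) unfolding orthonormal_basis_def by blast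
  then show ?thesis by simp
qed

lemma penalty_domain_summable:
  assumes "x \<in> penalty_domain q w u" "\<And>k. 1 \<le> k \<Longrightarrow> 0 \<le> w k"
  shows "summable (\<lambda>k. w (k + 1) * \<bar>x \<bullet> u (k + 1)\<bar> powr q)"
  using assms by (intro summable_ereal) (auto simp: penalty_domain_def penalty_def)

lemma penalty_eq_suminf:
  assumes "summable (\<lambda>k. w (k + 1) * \<bar>x \<bullet> u (k + 1)\<bar> powr q)"
  shows "penalty q w u x = ereal (\<Sum>k. w (k + 1) * \<bar>x \<bullet> u (k + 1)\<bar> powr q)"
  unfolding penalty_def by (rule suminf_ereal'[OF assms])

text \<open>Termwise subadditivity gives a summable majorant. Thus the penalty of the difference is
  finite too, and all three penalties in the inequality can be treated as real series.\<close>

lemma summable_penalty_diff: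
  assumes "summable (\<lambda>k. w (k + 1) * \<bar>x \<bullet> u (k + 1)\<bar> powr q)"
    and "summable (\<lambda>k. w (k + 1) * \<bar>z \<bullet> u (k + 1)\<bar> powr q)"
    and "\<And>k. 1 \<le> k \<Longrightarrow> 0 \<le> w k" "0 < q" "q \<le> 1"
  shows "summable (\<lambda>k. w (k + 1) * \<bar>(x - z) \<bullet> u (k + 1)\<bar> powr q)"
proof (rule summable_comparison_test'[OF summable_add[OF assms(1,2)], of 0])
  fix k
  have "w (k + 1) * \<bar>(x - z) \<bullet> u (k + 1)\<bar> powr q
      \<le> w (k + 1) * (\<bar>x \<bullet> u (k + 1)\<bar> powr q + \<bar>z \<bullet> u (k + 1)\<bar> powr q)"
    unfolding inner_diff_left using assms(3-5) by (intro mult_left_mono abs_diff_powr_le) auto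
  then show "norm (w (k + 1) * \<bar>(x - z) \<bullet> u (k + 1)\<bar> powr q)
      \<le> w (k + 1) * \<bar>x \<bullet> u (k + 1)\<bar> powr q + w (k + 1) * \<bar>z \<bullet> u (k + 1)\<bar> powr q"
    using assms(3) by (simp add: abs_mult distrib_left)
qed

section \<open>The rate function as an abstract infimum: \<open>T n\<close> for the tail,
  \<open>s n\<close> for the source sum\<close>

lemma rate_INF_bdd_below:
  fixes T s :: "nat \<Rightarrow> real"
  assumes "\<And>n. 0 \<le> T n" "\<And>n. 0 \<le> s n"
  shows "bdd_below ((\<lambda>n. T n + t powr q * s n) ` I)"
  using assms by (intro bdd_belowI2[of _ 0]) simp

lemma rate_INF_concave:
  fixes T s :: "nat \<Rightarrow> real"
  assumes "\<And>n. 0 \<le> T n" "\<And>n. 0 \<le> s n" "0 < q" "q \<le> 1"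
  shows "concave_on {0<..} (\<lambda>t. 2 * (INF n\<in>{1..}. T n + t powr q * s n))"
proof (intro concave_on_cmul concave_on_INF)
  fix n
  have "concave_on {0<..} (\<lambda>t. s n * t powr q)"
    using assms by (intro concave_on_cmul powr_concave) auto
  then show "concave_on {0<..} (\<lambda>t. T n + t powr q * s n)"
    by (intro concave_on_add) (auto simp: concave_on_const mult.commute)
qed (use assms rate_INF_bdd_below in auto)

text \<open>Positivity is the delicate point, since an infimum of positive numbers may vanish. Here
  \<open>T n\<close> stays above \<open>c\<close> before \<open>m\<close> and \<open>s n\<close>
  stays above \<open>d\<close> from \<open>m\<close> on, so \<open>min c (t powr q * d)\<close> is a
  positive lower bound uniform in \<open>n\<close>.\<close>

lemma rate_INF_index_function:
  fixes T s :: "nat \<Rightarrow> real"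
  assumes T: "\<And>n. 0 \<le> T n" "T \<longlonglongrightarrow> 0" and s: "\<And>n. 0 \<le> s n" and q: "0 < q"
    and T_pos: "0 < c" "\<And>n. n < m \<Longrightarrow> c \<le> T n" and s_pos: "0 < d" "\<And>n. m \<le> n \<Longrightarrow> d \<le> s n"
  shows "index_function (\<lambda>t. 2 * (INF n\<in>{1..}. T n + t powr q * s n))"
  unfolding index_function_def
proof (intro conjI allI impI)
  fix t :: real assume t: "0 < t"
  have "min c (t powr q * d) \<le> T n + t powr q * s n" for n
  proof (cases "n < m")
    case True
    then show ?thesis using T_pos(2)[of n] s[of n] by (simp add: min.coboundedI1 add_increasing2)
  next
    case False
    then have "t powr q * d \<le> t powr q * s n" by (intro mult_left_mono s_pos) auto
    then show ?thesis using T(1)[of n] by linarith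
  qed
  then have "min c (t powr q * d) \<le> (INF n\<in>{1..}. T n + t powr q * s n)"
    by (intro cINF_greatest) auto
  moreover have "0 < min c (t powr q * d)" using T_pos(1) s_pos(1) t by simp
  ultimately show "0 < 2 * (INF n\<in>{1..}. T n + t powr q * s n)" by linarith
next
  note bdd = rate_INF_bdd_below[OF T(1) s]
  show "mono_on {0<..} (\<lambda>t. 2 * (INF n\<in>{1..}. T n + t powr q * s n))"
  proof (rule mono_onI)
    fix t t' :: real assume t: "t \<in> {0<..}" "t \<le> t'"
    have "T n + t powr q * s n \<le> T n + t' powr q * s n" for n
      using t q s by (intro add_left_mono mult_right_mono powr_mono2) auto
    then have "(INF n\<in>{1..}. T n + t powr q * s n) \<le> (INF n\<in>{1..}. T n + t' powr q * s n)"
      by (intro cINF_mono bdd bexI) auto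
    then show "2 * (INF n\<in>{1..}. T n + t powr q * s n) \<le> 2 * (INF n\<in>{1..}. T n + t' powr q * s n)"
      by simp
  qed
next
  note bdd = rate_INF_bdd_below[OF T(1) s]
  show "((\<lambda>t. 2 * (INF n\<in>{1..}. T n + t powr q * s n)) \<longlongrightarrow> 0) (at_right 0)"
  proof (rule order_tendstoI)
    fix e :: real assume "e < 0"
    moreover have "0 \<le> (INF n\<in>{1..}. T n + t powr q * s n)" for t
      using T(1) s by (intro cINF_greatest) auto
    ultimately show "\<forall>\<^sub>F t in at_right 0. e < 2 * (INF n\<in>{1..}. T n + t powr q * s n)"
      by (intro always_eventually allI) (meson less_le_trans mult_nonneg_nonneg zero_le_numeral)
  next
    fix e :: real assume "0 < e"
    \<comment> \<open>Choose the truncation index first, making the tail small, and only then let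
      \<open>t\<close> tend to 0. The index must be at least 1 to be admissible in the
      infimum.\<close>
    then have "\<forall>\<^sub>F n in sequentially. T n < e / 2 \<and> 1 \<le> n"
      using order_tendstoD(2)[OF T(2), of "e / 2"]
      by (intro eventually_conj eventually_ge_at_top) auto
    then obtain n where n: "T n < e / 2" "1 \<le> n"
      using eventually_happens'[OF sequentially_bot] by blast
    have "((\<lambda>t. t powr q) \<longlongrightarrow> 0) (at_right 0)"
      \<comment> \<open>At base 0 this limit rule requires a positive exponent and an eventually
        nonnegative base; the limit is then \<open>0 powr q = 0\<close>.\<close>
      using q tendsto_powr'[of "\<lambda>t. t" 0 "at_right 0" "\<lambda>_. q" q]
      by (auto simp: eventually_at_right_less tendsto_ident_at eventually_at_filter)
    then have "((\<lambda>t. T n + t powr q * s n) \<longlongrightarrow> T n + 0 * s n) (at_right 0)"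
      by (intro tendsto_intros)
    then have "\<forall>\<^sub>F t in at_right 0. T n + t powr q * s n < e / 2"
      using n by (intro order_tendstoD(2)) auto
    then show "\<forall>\<^sub>F t in at_right 0. 2 * (INF n\<in>{1..}. T n + t powr q * s n) < e"
    proof eventually_elim
      case (elim t)
      moreover have "(INF n\<in>{1..}. T n + t powr q * s n) \<le> T n + t powr q * s n"
        using n by (intro cINF_lower bdd) auto
      ultimately show ?case by linarith
    qed
  qed
qed

section \<open>The variational inequality for a fixed truncation index\<close>

lemma dual_adjoint_coefficient_le:
  fixes A :: "'a::{real_inner, complete_space} \<Rightarrow>\<^sub>L 'b::banach"
  assumes "v = dual_adjoint A g"
  shows "\<bar>z \<bullet> v\<bar> \<le> norm g * norm (blinfun_apply A z)"
  using norm_blinfun[of g "blinfun_apply A z"] dual_adjoint[of g A z] assms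
  by (simp add: inner_commute)

lemma variational_inequality_truncated:
  fixes A :: "'a::{real_inner, complete_space} \<Rightarrow>\<^sub>L 'b::banach"
  assumes w: "\<And>k. 1 \<le> k \<Longrightarrow> 0 \<le> w k" and q: "0 < q" "q \<le> 1"
    and source: "\<And>k. k \<in> coeff_supp u xd \<Longrightarrow> u k = dual_adjoint A (f k)"
    and sum_x: "summable (\<lambda>k. w (k + 1) * \<bar>x \<bullet> u (k + 1)\<bar> powr q)"
    and sum_xd: "summable (\<lambda>k. w (k + 1) * \<bar>xd \<bullet> u (k + 1)\<bar> powr q)"
  shows "(\<Sum>k. w (k + 1) * \<bar>(x - xd) \<bullet> u (k + 1)\<bar> powr q)
      - (\<Sum>k. w (k + 1) * \<bar>x \<bullet> u (k + 1)\<bar> powr q)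
      + (\<Sum>k. w (k + 1) * \<bar>xd \<bullet> u (k + 1)\<bar> powr q)
    \<le> 2 * ((\<Sum>j. w (n + 1 + j) * \<bar>xd \<bullet> u (n + 1 + j)\<bar> powr q)
        + norm (blinfun_apply A (x - xd)) powr q
          * (\<Sum>k\<in>coeff_supp u xd \<inter> {1..n}. w k * norm (f k) powr q))"
proof -
  define t where "t = norm (blinfun_apply A (x - xd))"
  define D where "D k = w (k + 1) * \<bar>(x - xd) \<bullet> u (k + 1)\<bar> powr q" for k
  define P where "P k = w (k + 1) * \<bar>x \<bullet> u (k + 1)\<bar> powr q" for k
  define Q where "Q k = w (k + 1) * \<bar>xd \<bullet> u (k + 1)\<bar> powr q" for k
  \<comment> \<open>Extension by zero off the support turns the sum over S_n into a sum over all
    indices from 1 to \<open>n\<close>.\<close>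
  define E where "E k = (if k \<in> coeff_supp u xd then w k * norm (f k) powr q else 0)" for k
  have summable: "summable D" "summable P" "summable Q"
    using sum_x sum_xd summable_penalty_diff[OF sum_x sum_xd w q]
    unfolding D_def P_def Q_def by auto
  then have summable_G: "summable (\<lambda>k. D k - P k + Q k)"
    by (intro summable_add summable_diff)
  have D_le: "D k \<le> P k + Q k" for k
    unfolding D_def P_def Q_def inner_diff_left distrib_left[symmetric]
    using w q by (intro mult_left_mono abs_diff_powr_le) auto
  \<comment> \<open>Subadditivity applied to \<open>xd = x - (x - xd)\<close>.\<close>
  have Q_le: "Q k \<le> P k + D k" for k
    unfolding D_def P_def Q_def distrib_left[symmetric]
    using w q abs_diff_powr_le[of q "x \<bullet> u (k + 1)" "(x - xd) \<bullet> u (k + 1)"]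
    by (intro mult_left_mono) (auto simp: inner_diff_left)
  have head: "D k - P k + Q k \<le> 2 * (t powr q * E (Suc k))" for k
  proof (cases "Suc k \<in> coeff_supp u xd")
    case True
    have "\<bar>(x - xd) \<bullet> u (k + 1)\<bar> powr q \<le> (norm (f (k + 1)) * t) powr q"
      unfolding t_def using q dual_adjoint_coefficient_le[OF source[OF True]]
      by (intro powr_mono2) auto
    then have "D k \<le> w (k + 1) * (norm (f (k + 1)) * t) powr q"
      unfolding D_def using w by (intro mult_left_mono) auto
    then have "D k \<le> t powr q * E (Suc k)"
      using True by (simp add: E_def powr_mult mult_ac)
    then show ?thesis using Q_le[of k] by linarith
  next
    \<comment> \<open>Off the support no functional is available, but there \<open>Q k\<close>
      vanishes, so \<open>D_le\<close> already makes the left side nonpositive.\<close>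
    case False
    then have "Q k = 0" by (simp add: Q_def coeff_supp_def)
    then show ?thesis using D_le[of k] False by (simp add: E_def)
  qed
  have "suminf D - suminf P + suminf Q = (\<Sum>k. D k - P k + Q k)"
    using summable by (simp add: suminf_add[symmetric] suminf_diff[symmetric] summable_diff)
  \<comment> \<open>The term numbered \<open>k\<close> belongs to the basis vector
    \<open>u (k + 1)\<close>, so the finite part covers basis indices 1 to \<open>n\<close> and the
    shifted series those from \<open>n + 1\<close> on.\<close>
  also have "\<dots> = (\<Sum>k. D (k + n) - P (k + n) + Q (k + n)) + (\<Sum>k<n. D k - P k + Q k)"
    by (rule suminf_split_initial_segment[OF summable_G])
  also have "\<dots> \<le> (\<Sum>k. 2 * Q (k + n)) + (\<Sum>k<n. 2 * (t powr q * E (Suc k)))"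
  proof (intro add_mono sum_mono suminf_le head)
    show "D (k + n) - P (k + n) + Q (k + n) \<le> 2 * Q (k + n)" for k
      using D_le[of "k + n"] by linarith
    show "summable (\<lambda>k. D (k + n) - P (k + n) + Q (k + n))"
      using summable_ignore_initial_segment[OF summable_G, of n] by simp
    show "summable (\<lambda>k. 2 * Q (k + n))"
      using summable_ignore_initial_segment[OF summable(3), of n] by (intro summable_mult)
  qed
  also have "(\<Sum>k. 2 * Q (k + n)) = 2 * (\<Sum>k. Q (k + n))"
    using summable_ignore_initial_segment[OF summable(3), of n] by (rule suminf_mult)
  also have "(\<Sum>k<n. 2 * (t powr q * E (Suc k))) = 2 * (t powr q * (\<Sum>k<n. E (Suc k)))"
    by (simp add: sum_distrib_left)
  also have "(\<Sum>k<n. E (Suc k)) = (\<Sum>k\<in>{1..n}. E k)"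
    by (rule sum.atLeast1_atMost_eq[symmetric, folded One_nat_def])
  also have "\<dots> = (\<Sum>k\<in>coeff_supp u xd \<inter> {1..n}. w k * norm (f k) powr q)"
    unfolding E_def by (simp add: sum.inter_restrict[symmetric] Int_commute)
  finally show ?thesis
    by (simp add: D_def P_def Q_def t_def add_ac distrib_left)
qed

section \<open>Properties of the concrete rate function, and passage to the infimum\<close>

theorem theorem3:
  fixes A :: "'a::{real_inner, complete_space} \<Rightarrow>\<^sub>L 'b::banach"
    and u :: "nat \<Rightarrow> 'a" and w :: "nat \<Rightarrow> real" and w0 q :: real
    and y :: 'b and xd :: 'a and f :: "nat \<Rightarrow> ('b \<Rightarrow>\<^sub>L real)"
  assumes separable: "separable_space (euclidean :: 'a topology)"
    and infinite_dim: "\<nexists>B :: 'a set. finite B \<and> span B = UNIV"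
    and inj: "inj (blinfun_apply A)"
    and nonclosed: "\<not> closed (range (blinfun_apply A))"
    and basis: "orthonormal_basis u"
    and weights: "0 < w0" "\<And>k. k \<ge> 1 \<Longrightarrow> w0 \<le> w k"
    and q: "0 < q" "q \<le> 1"
    and y: "y \<in> range (blinfun_apply A)"
    and solution: "blinfun_apply A xd = y"
    and sparse: "xd \<in> penalty_domain q w u"
    and source: "\<And>k. k \<in> coeff_supp u xd \<Longrightarrow> u k = dual_adjoint A (f k)"
  shows "(\<forall>x\<in>penalty_domain q w u.
            penalty q w u (x - xd) \<le> penalty q w u x - penalty q w u xd
              + ereal (rate_function q w u f xd (norm (blinfun_apply A (x - xd)))))
         \<and> concave_on {0<..} (rate_function q w u f xd)
         \<and> (xd \<noteq> 0 \<longrightarrow> index_function (rate_function q w u f xd))"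
proof (intro conjI ballI impI)
  have w_pos: "0 < w k" if "1 \<le> k" for k
    using weights(1) weights(2)[OF that] by linarith
  then have w_nonneg: "0 \<le> w k" if "1 \<le> k" for k
    using that less_imp_le by blast
  note summable_dom = penalty_domain_summable[OF _ w_nonneg]
  note sum_xd = summable_dom[OF sparse]
  define T where "T n = (\<Sum>j. w (n + 1 + j) * \<bar>xd \<bullet> u (n + 1 + j)\<bar> powr q)" for n
  define s where "s n = (\<Sum>k\<in>coeff_supp u xd \<inter> {1..n}. w k * norm (f k) powr q)" for n
  have rate: "rate_function q w u f xd = (\<lambda>t. 2 * (INF n\<in>{1..}. T n + t powr q * s n))"
    by (simp add: fun_eq_iff rate_function_def T_def s_def)
  have sum_tail: "summable (\<lambda>j. w (n + 1 + j) * \<bar>xd \<bullet> u (n + 1 + j)\<bar> powr q)" for n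
    using summable_ignore_initial_segment[OF sum_xd, of n] by (simp add: add_ac)
  have T_nonneg: "0 \<le> T n" for n
    unfolding T_def using sum_tail by (rule suminf_nonneg) (simp add: w_nonneg)
  have s_nonneg: "0 \<le> s n" for n
    unfolding s_def by (intro sum_nonneg mult_nonneg_nonneg) (auto simp: w_nonneg)
  show "concave_on {0<..} (rate_function q w u f xd)"
    unfolding rate by (rule rate_INF_concave[OF T_nonneg s_nonneg q])
  show "index_function (rate_function q w u f xd)" if "xd \<noteq> 0"
  proof -
    \<comment> \<open>For \<open>xd = 0\<close> the rate function is identically 0. A nonzero
      coefficient at \<open>m\<close> supplies both positive lower bounds: it occurs in every tail
      with \<open>n < m\<close>, and \<open>f m\<close> enters every source sum with
      \<open>m\<close> \<le> \<open>n\<close>.\<close>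
    obtain m where m: "1 \<le> m" "xd \<bullet> u m \<noteq> 0"
      using orthonormal_basis_inner_eq_0[OF basis] \<open>xd \<noteq> 0\<close> by blast
    then have m_supp: "m \<in> coeff_supp u xd" by (simp add: coeff_supp_def)
    \<comment> \<open>A zero functional would force the coefficient \<open>xd \<bullet> u m\<close>
      to vanish.\<close>
    have "norm (f m) \<noteq> 0"
      using dual_adjoint_coefficient_le[OF source[OF m_supp], of xd] m by auto
    have T_eq: "T n = (\<Sum>k. w (k + n + 1) * \<bar>xd \<bullet> u (k + n + 1)\<bar> powr q)" for n
      by (simp add: T_def add_ac)
    show ?thesis
      unfolding rate
    proof (rule rate_INF_index_function[OF T_nonneg _ s_nonneg q(1)])
      show "T \<longlonglongrightarrow> 0"
        unfolding T_eq
        using suminf_exist_split[OF _ sum_xd] by (auto simp: LIMSEQ_iff)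
      show "0 < w m * \<bar>xd \<bullet> u m\<bar> powr q" using m w_pos by simp
      show "w m * \<bar>xd \<bullet> u m\<bar> powr q \<le> T n" if "n < m" for n
        \<comment> \<open>The tail starts at index \<open>n + 1\<close>, so the \<open>m\<close>-th
          term sits at offset \<open>m - n - 1\<close>.\<close>
        using sum_le_suminf[OF sum_tail, of "{m - n - 1}" n] that w_nonneg
        by (simp add: T_def)
      show "0 < w m * norm (f m) powr q" using m w_pos \<open>norm (f m) \<noteq> 0\<close> by simp
      show "w m * norm (f m) powr q \<le> s n" if "m \<le> n" for n
        unfolding s_def using m m_supp that w_nonneg
        by (intro member_le_sum) auto
    qed
  qed
  fix x assume x: "x \<in> penalty_domain q w u"
  note sum_x = summable_dom[OF x]
  define t where "t = norm (blinfun_apply A (x - xd))"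
  define d where "d = (\<Sum>k. w (k + 1) * \<bar>(x - xd) \<bullet> u (k + 1)\<bar> powr q)
      - (\<Sum>k. w (k + 1) * \<bar>x \<bullet> u (k + 1)\<bar> powr q)
      + (\<Sum>k. w (k + 1) * \<bar>xd \<bullet> u (k + 1)\<bar> powr q)"
  have "d \<le> 2 * (T n + t powr q * s n)" for n
    unfolding d_def T_def s_def t_def
    using w_nonneg q source sum_x sum_xd by (rule variational_inequality_truncated)
  \<comment> \<open>Since \<open>d\<close> does not depend on \<open>n\<close>, half of it is a
    common lower bound of all the truncated expressions.\<close>
  then have "d / 2 \<le> (INF n\<in>{1..}. T n + t powr q * s n)"
    by (intro cINF_greatest) (auto simp: mult.commute)
  then have "d \<le> rate_function q w u f xd t" by (simp add: rate)
  then show "penalty q w u (x - xd) \<le> penalty q w u x - penalty q w u xd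
      + ereal (rate_function q w u f xd (norm (blinfun_apply A (x - xd))))"
    \<comment> \<open>All three penalties are finite, so the extended-real claim is a rearrangement
      of the real bound on \<open>d\<close>.\<close>
    using penalty_eq_suminf[of w x u q, OF sum_x] penalty_eq_suminf[of w xd u q, OF sum_xd]
      penalty_eq_suminf[of w "x - xd" u q, OF summable_penalty_diff[OF sum_x sum_xd w_nonneg q]]
    by (simp add: d_def t_def)
qed

end
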